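(* For every natural number $n$, $\omega\to(\widetilde{\mathcal{ED}}_\omega^+)^2_n$; in particular $\omega\to(\mathcal{PC}^+)^2_n$.
   Context: Fix a family $\{A_s\subseteq\omega: s\in\omega^{<\omega}\}$ such that $A_\emptyset=\omega$, every $A_s$ is infinite, $\{A_{s^\frown n}:n\in\omega\}$ is a partition of $A_s$, and for distinct $n,m\in\omega$ there exist $s\neq t$ in $\omega^{<\omega}$ with $n\in A_s$, $m\in A_t$. Let $\mathcal{B}=\{A\subseteq\omega: \exists s\in\omega^{<\omega}\,(A\subseteq A_s\wedge\forall n\in\omega\ |A\cap A_{s^\frown n}|=1)\}$ and $\mathcal{A}_m=\{A_s: |s|=m+1\}$. $\widetilde{\mathcal{ED}}_m$ is the ideal on $\omega$ generated by $\mathcal{A}_m\cup\mathcal{B}$ (and finite sets), and $\widetilde{\mathcal{ED}}_\omega=\bigcap_{m\in\omega}\widetilde{\mathcal{ED}}_m$. For $A\subseteq\omega$ let $T_A=\{s: A\cap A_s\neq\emptyset\}$; a tree $T\subseteq\omega^{<\omega}$ is small-branching if each $s\in T$ has at most $|s|+1$ immediate successors in $T$. $\mathcal{PC}$ is the ideal generated by $\mathcal{B}\cup\{A\subseteq\omega: T_A\text{ is small-branching}\}$ (and finite sets). For an ideal $\mathcal{I}$, $\mathcal{I}^+$ is the family of sets not in $\mathcal{I}$, and $\omega\to(\mathcal{I}^+)^2_n$ means: for every $c:[\omega]^2\to n$ there is $A\in\mathcal{I}^+$ with $|c[[A]^2]|=1$. *)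

theory Defs
  imports "HOL-Library.Ramsey" "HOL-Library.Disjoint_Sets"
begin

text \<open>
  The set \<open>\<omega>\<close> is the type \<^typ>\<open>nat\<close>, finite sequences are of type \<^typ>\<open>nat list\<close>, and the
  sequence \<open>s\<close> extended by \<open>n\<close> is \<open>s @ [n]\<close>.
\<close>

text \<open>
  The last conjunct is the literal form of the separation condition. As it stands it already
  follows from the other conjuncts; the presumably intended condition (that \<open>s\<close> and \<open>t\<close> can in
  addition be chosen with disjoint \<open>A s\<close> and \<open>A t\<close>) is stronger, so a statement about all
  families in the sense below covers that reading as well.
\<close>

definition partition_family :: "(nat list \<Rightarrow> nat set) \<Rightarrow> bool" where
  "partition_family A \<longleftrightarrow>
     A [] = UNIV \<and>
     (\<forall>s. infinite (A s)) \<and>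
     (\<forall>s. disjoint_family (\<lambda>n. A (s @ [n])) \<and> (\<Union>n. A (s @ [n])) = A s) \<and>
     (\<forall>n m. n \<noteq> m \<longrightarrow> (\<exists>s t. s \<noteq> t \<and> n \<in> A s \<and> m \<in> A t))"

text \<open>Ideals contain all finite sets; properness is not part of the definition.\<close>

definition is_ideal :: "nat set set \<Rightarrow> bool" where
  "is_ideal I \<longleftrightarrow>
     (\<forall>X. finite X \<longrightarrow> X \<in> I) \<and>
     (\<forall>X\<in>I. \<forall>Y. Y \<subseteq> X \<longrightarrow> Y \<in> I) \<and>
     (\<forall>X\<in>I. \<forall>Y\<in>I. X \<union> Y \<in> I)"

definition ideal_gen :: "nat set set \<Rightarrow> nat set set" where
  "ideal_gen G = \<Inter> {I. is_ideal I \<and> G \<subseteq> I}"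

definition positive :: "nat set set \<Rightarrow> nat set set" where
  "positive I = {X. X \<notin> I}"

definition \<B> :: "(nat list \<Rightarrow> nat set) \<Rightarrow> nat set set" where
  "\<B> A = {X. \<exists>s. X \<subseteq> A s \<and> (\<forall>n. card (X \<inter> A (s @ [n])) = 1)}"

definition \<A> :: "(nat list \<Rightarrow> nat set) \<Rightarrow> nat \<Rightarrow> nat set set" where
  "\<A> A m = {A s | s. length s = m + 1}"

definition ED :: "(nat list \<Rightarrow> nat set) \<Rightarrow> nat \<Rightarrow> nat set set" where
  "ED A m = ideal_gen (\<A> A m \<union> \<B> A)"

definition ED_omega :: "(nat list \<Rightarrow> nat set) \<Rightarrow> nat set set" where
  "ED_omega A = (\<Inter>m. ED A m)"

definition tree_of :: "(nat list \<Rightarrow> nat set) \<Rightarrow> nat set \<Rightarrow> nat list set" where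
  "tree_of A X = {s. X \<inter> A s \<noteq> {}}"

text \<open>Finiteness is required separately because \<^const>\<open>card\<close> is 0 on infinite sets.\<close>

definition small_branching :: "nat list set \<Rightarrow> bool" where
  "small_branching T \<longleftrightarrow>
     (\<forall>s\<in>T. finite {n. s @ [n] \<in> T} \<and> card {n. s @ [n] \<in> T} \<le> length s + 1)"

definition PC :: "(nat list \<Rightarrow> nat set) \<Rightarrow> nat set set" where
  "PC A = ideal_gen (\<B> A \<union> {X. small_branching (tree_of A X)})"

text \<open>The partition relation \<open>\<omega> \<rightarrow> (F)\<^sup>2\<^sub>n\<close>; the number \<open>n\<close> is the set \<open>{..<n}\<close> of colours.\<close>

definition arrows_pairs :: "nat set set \<Rightarrow> nat \<Rightarrow> bool" where
  "arrows_pairs F n \<longleftrightarrow>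
     (\<forall>c. c \<in> nsets (UNIV :: nat set) 2 \<rightarrow> {..<n} \<longrightarrow> (\<exists>X\<in>F. card (c ` nsets X 2) = 1))"

end

theory Submission
  imports Defs
begin

text \<open>
  Call a set large of rank \<open>h\<close> at \<open>s\<close> if it is positive for the \<open>(h+1)\<close>-fold Fubini power of the
  ideal of finite sets, read off the tree above \<open>s\<close>. Largeness is partition regular, so a large set
  can be thinned out to a decreasing sequence of large sets \<open>Z k\<close> such that all pairs between a point
  \<open>x\<close> and \<open>Z k\<close> with \<open>k > x\<close> have one fixed colour \<open>d\<close>. If every large part of the columns
  \<open>A (s @ [i])\<close> contains arbitrarily big finite \<open>d\<close>-homogeneous sets, these can be glued together to
  a \<open>d\<close>-homogeneous set with unboundedly big traces on the columns, and such a set is positive for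
  \<open>ED A (length s)\<close>. Otherwise some large part of a column bounds the size of its
  \<open>d\<close>-homogeneous subsets, and one continues inside that column. No colour can occur again as \<open>d\<close>
  once it has been bounded, so after at most \<open>n\<close> steps the first alternative must hold.
\<close>

section \<open>Homogeneous sets and end-homogeneous sequences\<close>

definition homogeneous :: "(nat set \<Rightarrow> 'c) \<Rightarrow> 'c \<Rightarrow> nat set \<Rightarrow> bool" where
  "homogeneous c d X \<longleftrightarrow> (\<forall>x\<in>X. \<forall>y\<in>X. x \<noteq> y \<longrightarrow> c {x, y} = d)"

text \<open>The indices are compared with the points themselves: if \<open>k\<close> exceeds every
  element of a finite \<open>F \<subseteq> Z 0\<close>, then all points of \<open>Z k\<close>
  outside \<open>F\<close> are joined to \<open>F\<close> in colour \<open>d\<close>. This is how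
  \<open>F\<close> gets extended. \<open>Z k\<close> may still contain points below
  \<open>k\<close>, hence the clause \<open>x \<noteq> y\<close>.\<close>

definition end_homogeneous :: "(nat set \<Rightarrow> 'c) \<Rightarrow> 'c \<Rightarrow> (nat \<Rightarrow> nat set) \<Rightarrow> bool" where
  "end_homogeneous c d Z \<longleftrightarrow> (\<forall>x\<in>Z 0. \<forall>k>x. \<forall>y\<in>Z k. x \<noteq> y \<longrightarrow> c {x, y} = d)"

lemma homogeneous_Un:
  assumes "homogeneous c d X" "homogeneous c d Y"
    and "\<And>x y. x \<in> X \<Longrightarrow> y \<in> Y \<Longrightarrow> x \<noteq> y \<Longrightarrow> c {x, y} = d"
  shows "homogeneous c d (X \<union> Y)"
proof -
  have "c {y, x} = d" if "x \<in> X" "y \<in> Y" "x \<noteq> y" for x y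
    using assms(3)[OF that] by (simp add: insert_commute)
  with assms show ?thesis unfolding homogeneous_def by blast
qed

lemma homogeneous_UN_chain:
  assumes "\<And>m::nat. homogeneous c d (X m)" and "mono X"
  shows "homogeneous c d (\<Union>m. X m)"
  unfolding homogeneous_def
proof (intro ballI impI)
  fix x y assume "x \<in> (\<Union>m. X m)" "y \<in> (\<Union>m. X m)" and "x \<noteq> y"
  then obtain k l where "x \<in> X k" "y \<in> X l" by blast
  then have "x \<in> X (max k l)" "y \<in> X (max k l)"
    using monoD[OF \<open>mono X\<close>, of k "max k l"] monoD[OF \<open>mono X\<close>, of l "max k l"] by auto
  then show "c {x, y} = d"
    using assms(1) \<open>x \<noteq> y\<close> unfolding homogeneous_def by blast
qed

text \<open>Stage \<open>k\<close> shrinks the current set so that the point \<open>k\<close> sees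
  all the rest in one colour \<open>\<delta> k\<close>. Keeping only the points \<open>y\<close>
  with \<open>\<delta> y = d\<close> then makes the colour independent of the point. A sequence
  results rather than one set, since \<open>P\<close> need not survive infinite
  intersections.\<close>

lemma end_homogeneous_sequence:
  fixes P :: "nat set \<Rightarrow> bool" and c :: "nat set \<Rightarrow> nat"
  assumes P_cover: "\<And>Y F. P Y \<Longrightarrow> Y \<subseteq> (\<Union>d<n. F d) \<Longrightarrow> \<exists>d<n. P (Y \<inter> F d)"
    and P_mono: "\<And>Y Y'. P Y \<Longrightarrow> Y \<subseteq> Y' \<Longrightarrow> P Y'"
    and c: "\<forall>x y. x \<noteq> y \<longrightarrow> c {x, y} < n"
    and "n > 0" and "P Y"
  obtains d Z where "d < n" "antimono Z" "\<And>k. P (Z k)" "Z 0 \<subseteq> Y"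
    "end_homogeneous c d Z"
proof -
  \<comment> \<open>The point \<open>k\<close> itself goes into every \<open>V k d\<close>, because
    \<open>c {k}\<close> is not controlled and the classes have to cover.\<close>
  define V where "V k d = {y. y = k \<or> c {k, y} = d}" for k d
  have "\<exists>d<n. P (W \<inter> V k d)" if "P W" for W k
  proof (rule P_cover[OF that])
    show "W \<subseteq> (\<Union>d<n. V k d)"
    proof
      fix y
      show "y \<in> (\<Union>d<n. V k d)"
        by (cases "y = k") (use c \<open>n > 0\<close> in \<open>auto simp: V_def\<close>)
    qed
  qed
  then obtain g where g: "\<And>W k. P W \<Longrightarrow> g W k < n \<and> P (W \<inter> V k (g W k))"
    by metis
  define W where "W = rec_nat Y (\<lambda>k W. W \<inter> V k (g W k))"
  have W_simps: "W 0 = Y" "W (Suc k) = W k \<inter> V k (g (W k) k)" for k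
    by (simp_all add: W_def)
  define \<delta> where "\<delta> k = g (W k) k" for k
  have PW: "P (W k)" for k
    by (induction k) (use \<open>P Y\<close> g in \<open>auto simp: W_simps\<close>)
  have \<delta>: "\<delta> k < n" for k using g PW by (simp add: \<delta>_def)
  have decW: "antimono W" by (auto simp: antimono_iff_le_Suc W_simps)
  \<comment> \<open>Now \<open>W k\<close> is split according to the colour attached to each of its
    points. The class chosen may depend on \<open>k\<close>; a colour chosen for infinitely many
    \<open>k\<close> works for all of them, as \<open>W\<close> decreases.\<close>
  have "\<exists>d<n. P (W k \<inter> \<delta> -` {d})" for k
    by (rule P_cover[OF PW]) (use \<delta> in auto)
  then obtain e where e: "\<And>k. e k < n" "\<And>k. P (W k \<inter> \<delta> -` {e k})" by metis
  have "\<exists>d\<in>{..<n}. infinite {k. e k = d}"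
    using pigeonhole_infinite_rel[of UNIV "{..<n}" "\<lambda>k d. e k = d"] e(1) by auto
  then obtain d where d: "d < n" "infinite {k. e k = d}" by auto
  show thesis
  proof
    show "d < n" by fact
    show "antimono (\<lambda>k. W k \<inter> \<delta> -` {d})"
      using decW by (fastforce simp: antimono_def)
    show "P (W k \<inter> \<delta> -` {d})" for k
    proof -
      obtain l where "l \<ge> k" "e l = d"
        using d(2) by (metis (mono_tags, lifting) infinite_nat_iff_unbounded_le mem_Collect_eq)
      then show ?thesis
        using P_mono[OF e(2)[of l]] antimonoD[OF decW \<open>l \<ge> k\<close>] by blast
    qed
    show "W 0 \<inter> \<delta> -` {d} \<subseteq> Y" by (auto simp: W_simps)
    have "c {x, y} = d"
      if "x \<in> W 0 \<inter> \<delta> -` {d}" "x < k" "y \<in> W k \<inter> \<delta> -` {d}" "x \<noteq> y" for x k y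
      \<comment> \<open>The choice made for \<open>x\<close> first takes effect in
        \<open>W (Suc x)\<close>, whence the strict inequality \<open>x < k\<close>.\<close>
      using that antimonoD[OF decW, of "Suc x" k]
      by (auto simp: W_simps V_def \<delta>_def Suc_le_eq)
    then show "end_homogeneous c d (\<lambda>k. W k \<inter> \<delta> -` {d})"
      unfolding end_homogeneous_def by blast
  qed
qed

text \<open>Greedy choice: beyond a finite \<open>F\<close>, some \<open>Z k\<close> is joined to
  \<open>F\<close> in colour \<open>d\<close>, and being infinite it offers a point outside
  \<open>F\<close>.\<close>

lemma finite_homogeneous_subset:
  assumes hom: "end_homogeneous c d Z"
    and "antimono Z" and inf: "\<And>k. infinite (Z k)"
  shows "\<exists>F\<subseteq>Z 0. finite F \<and> card F = b \<and> homogeneous c d F"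
proof (induction b)
  case 0
  then show ?case by (intro exI[of _ "{}"]) (auto simp: homogeneous_def)
next
  case (Suc b)
  then obtain F where F: "F \<subseteq> Z 0" "finite F" "card F = b" "homogeneous c d F" by blast
  obtain k where k: "\<And>x. x \<in> F \<Longrightarrow> x < k"
    using F(2) finite_nat_set_iff_bounded by auto
  obtain y where y: "y \<in> Z k" "y \<notin> F"
    using inf[of k] F(2) by (meson finite_subset subsetI)
  have "homogeneous c d (F \<union> {y})"
    by (rule homogeneous_Un[OF F(4)]) (use hom F(1) k y in \<open>auto simp: homogeneous_def end_homogeneous_def\<close>)
  moreover have "y \<in> Z 0" using y antimonoD[OF \<open>antimono Z\<close>, of 0 k] by auto
  ultimately show ?case
    using F y by (intro exI[of _ "F \<union> {y}"]) auto
qed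

text \<open>Blocks are added one at a time. If \<open>k\<close> exceeds all points used so far, a
  homogeneous block inside \<open>Z k\<close> is joined to them in colour \<open>d\<close>. A block
  may overlap earlier ones, as only its own size matters for the trace on
  \<open>C i\<close>.\<close>

lemma glue_homogeneous_sets:
  fixes C :: "nat \<Rightarrow> nat set"
  assumes hom: "end_homogeneous c d Z"
    and "antimono Z"
    and blocks: "\<And>k b. \<exists>i\<ge>b. \<exists>F\<subseteq>Z k \<inter> C i. finite F \<and> card F = b \<and> homogeneous c d F"
  shows "\<exists>X. homogeneous c d X \<and> (\<forall>b. \<exists>i\<ge>b. \<exists>F\<subseteq>X \<inter> C i. finite F \<and> card F = b)"
proof -
  define Q where "Q X \<longleftrightarrow> finite X \<and> X \<subseteq> Z 0 \<and> homogeneous c d X" for X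
  \<comment> \<open>The number \<open>b\<close> is both the size of the block added at stage
    \<open>b\<close> and a lower bound for its column, so the traces are unbounded along the
    columns.\<close>
  define R where "R b X Y \<longleftrightarrow>
    X \<subseteq> Y \<and> (\<exists>i\<ge>b. \<exists>F\<subseteq>Y \<inter> C i. finite F \<and> card F = b)" for b X Y
  have "\<exists>X. \<forall>b. Q (X b) \<and> R b (X b) (X (Suc b))"
  proof (rule dependent_nat_choice)
    show "\<exists>X. Q X"
      by (intro exI[of _ "{}"]) (auto simp: Q_def homogeneous_def)
  next
    fix X and b :: nat assume "Q X"
    then obtain k where k: "\<And>x. x \<in> X \<Longrightarrow> x < k"
      using finite_nat_set_iff_bounded by (auto simp: Q_def)
    obtain i F where F: "i \<ge> b" "F \<subseteq> Z k \<inter> C i" "finite F" "card F = b" "homogeneous c d F"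
      using blocks by meson
    have "homogeneous c d (X \<union> F)"
      by (rule homogeneous_Un) (use \<open>Q X\<close> F hom k in \<open>auto simp: Q_def end_homogeneous_def subset_iff\<close>)
    moreover have "F \<subseteq> Z 0" using F(2) antimonoD[OF \<open>antimono Z\<close>, of 0 k] by auto
    ultimately have "Q (X \<union> F) \<and> R b X (X \<union> F)"
      using \<open>Q X\<close> F unfolding Q_def R_def by blast
    then show "\<exists>Y. Q Y \<and> R b X Y" by blast
  qed
  then obtain X where X: "\<And>b. Q (X b)" "\<And>b. R b (X b) (X (Suc b))" by blast
  have "mono X" using X(2) by (simp add: mono_iff_le_Suc R_def)
  then have "homogeneous c d (\<Union>b. X b)"
    using X(1) by (intro homogeneous_UN_chain) (auto simp: Q_def)
  moreover have "\<exists>i\<ge>b. \<exists>F\<subseteq>(\<Union>b. X b) \<inter> C i. finite F \<and> card F = b" for b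
  proof -
    obtain i F where "i \<ge> b" "F \<subseteq> X (Suc b) \<inter> C i" "finite F" "card F = b"
      using X(2)[of b] unfolding R_def by blast
    then show ?thesis by blast
  qed
  ultimately show ?thesis by blast
qed

section \<open>Generated ideals\<close>

lemma is_ideal_ideal_gen: "is_ideal (ideal_gen G)"
  unfolding is_ideal_def[of "ideal_gen G"]
proof (intro conjI allI ballI impI)
  fix X :: "nat set" assume "finite X"
  then show "X \<in> ideal_gen G" by (auto simp: ideal_gen_def is_ideal_def)
next
  fix X Y assume "X \<in> ideal_gen G" "Y \<subseteq> X"
  moreover have "Y \<in> I" if "is_ideal I" "X \<in> I" "Y \<subseteq> X" for I
    using that unfolding is_ideal_def by meson
  ultimately show "Y \<in> ideal_gen G" by (simp add: ideal_gen_def)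
next
  fix X Y assume "X \<in> ideal_gen G" "Y \<in> ideal_gen G"
  moreover have "X \<union> Y \<in> I" if "is_ideal I" "X \<in> I" "Y \<in> I" for I
    using that unfolding is_ideal_def by meson
  ultimately show "X \<union> Y \<in> ideal_gen G" by (simp add: ideal_gen_def)
qed

lemma ideal_gen_superset: "G \<subseteq> ideal_gen G"
  by (auto simp: ideal_gen_def)

lemma ideal_gen_least: "is_ideal I \<Longrightarrow> G \<subseteq> I \<Longrightarrow> ideal_gen G \<subseteq> I"
  by (auto simp: ideal_gen_def)

lemma ideal_finite_Union:
  assumes "is_ideal I" "finite S" "S \<subseteq> I"
  shows "\<Union>S \<in> I"
  using assms(2,3)
proof (induction S)
  case empty
  then show ?case using assms(1) by (simp add: is_ideal_def)
next
  case (insert X S)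
  then have "X \<in> I" "\<Union>S \<in> I" by auto
  then show ?case using assms(1) unfolding is_ideal_def by simp
qed

section \<open>Nodes of a partition family\<close>

context
  fixes A :: "nat list \<Rightarrow> nat set"
  assumes A: "partition_family A"
begin

lemma infinite_node: "infinite (A s)"
  using A by (simp add: partition_family_def)

lemma child_subset: "A (s @ [i]) \<subseteq> A s"
  using A unfolding partition_family_def by blast

lemma children_disjoint: "i \<noteq> j \<Longrightarrow> A (s @ [i]) \<inter> A (s @ [j]) = {}"
  using A unfolding partition_family_def disjoint_family_on_def by blast

lemma append_subset: "A (s @ r) \<subseteq> A s"
proof (induction r rule: rev_induct)
  case (snoc i r)
  then show ?case using child_subset[of "s @ r" i] by auto
qed simp

lemma take_superset: "A s \<subseteq> A (take k s)"
  using append_subset[of "take k s" "drop k s"] by simp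

lemma same_length_disjoint:
  "length s = length t \<Longrightarrow> s \<noteq> t \<Longrightarrow> A s \<inter> A t = {}"
proof (induction s arbitrary: t rule: rev_induct)
  case (snoc i s)
  then obtain j u where t: "t = u @ [j]" "length u = length s"
    by (cases t rule: rev_cases) auto
  show ?case
  proof (cases "s = u")
    case True
    then have "i \<noteq> j" using snoc.prems(2) t(1) by simp
    then show ?thesis using children_disjoint[of i j u] t(1) True by simp
  next
    case False
    then have "A s \<inter> A u = {}" using snoc.IH t by simp
    then show ?thesis using child_subset[of s i] child_subset[of u j] t by blast
  qed
qed simp

section \<open>Largeness and its partition regularity\<close>

primrec large :: "nat \<Rightarrow> nat list \<Rightarrow> nat set \<Rightarrow> bool" where
  "large 0 s Y \<longleftrightarrow> infinite (Y \<inter> A s)"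
| "large (Suc h) s Y \<longleftrightarrow> infinite {i. large h (s @ [i]) Y}"

lemma large_mono: "large h s Y \<Longrightarrow> Y \<subseteq> Y' \<Longrightarrow> large h s Y'"
proof (induction h arbitrary: s)
  case 0
  then show ?case by simp (meson Int_mono finite_subset order_refl)
next
  case (Suc h)
  then show ?case
    by simp (metis (mono_tags, lifting) Collect_mono finite_subset)
qed

text \<open>If infinitely many columns are large for the union, then by induction each is large for
  \<open>X\<close> or for \<open>Y\<close>, and one of the two alternatives occurs infinitely
  often.\<close>

lemma large_Un: "large h s (X \<union> Y) \<Longrightarrow> large h s X \<or> large h s Y"
proof (induction h arbitrary: s)
  case 0
  then show ?case by (simp add: Int_Un_distrib2)
next
  case (Suc h)
  have "{i. large h (s @ [i]) (X \<union> Y)} \<subseteq> {i. large h (s @ [i]) X} \<union> {i. large h (s @ [i]) Y}"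
    using Suc.IH by blast
  with Suc.prems show ?case by (auto dest: finite_subset)
qed

text \<open>Points picked from the infinitely many large columns are distinct because the columns
  are disjoint.\<close>

lemma infinite_if_large: "large h s Y \<Longrightarrow> infinite (Y \<inter> A s)"
proof (induction h arbitrary: s)
  case (Suc h)
  let ?I = "{i. large h (s @ [i]) Y}"
  have "\<exists>y. y \<in> Y \<inter> A (s @ [i])" if "i \<in> ?I" for i
    using Suc.IH[of "s @ [i]"] that by (metis ex_in_conv finite.emptyI mem_Collect_eq)
  then obtain p where p: "\<And>i. i \<in> ?I \<Longrightarrow> p i \<in> Y \<inter> A (s @ [i])" by metis
  have "inj_on p ?I"
    using p children_disjoint by (intro inj_onI) (metis IntD2 disjoint_iff)
  then have "infinite (p ` ?I)" using Suc.prems by (simp add: finite_image_iff)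
  moreover have "p ` ?I \<subseteq> Y \<inter> A s" using p child_subset by blast
  ultimately show ?case using finite_subset by blast
qed simp

lemma large_cover:
  fixes n :: nat
  shows "large h s Y \<Longrightarrow> Y \<subseteq> (\<Union>d<n. F d) \<Longrightarrow> \<exists>d<n. large h s (Y \<inter> F d)"
proof (induction n arbitrary: Y)
  case 0
  then show ?case using infinite_if_large[of h s Y] by auto
next
  case (Suc n)
  have "large h s ((Y \<inter> F n) \<union> (Y - F n))"
    by (rule large_mono[OF Suc.prems(1)]) auto
  then consider "large h s (Y \<inter> F n)" | "large h s (Y - F n)"
    using large_Un by blast
  then show ?case
  proof cases
    case 1
    then show ?thesis by blast
  next
    case 2
    moreover have "Y - F n \<subseteq> (\<Union>d<n. F d)"
      using Suc.prems(2) by (auto simp: lessThan_Suc)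
    ultimately obtain d where "d < n" "large h s ((Y - F n) \<inter> F d)"
      using Suc.IH by blast
    then show ?thesis
      by (intro exI[of _ d]) (auto elim: large_mono)
  qed
qed

text \<open>Largeness at \<open>s\<close> depends only on the part of \<open>Y\<close> inside
  \<open>A s\<close>, so one may pass into a column without losing rank there.\<close>

lemma large_restrict: "large h s Y \<Longrightarrow> large h s (Y \<inter> A s)"
proof (induction h arbitrary: s)
  case (Suc h)
  have "{i. large h (s @ [i]) Y} \<subseteq> {i. large h (s @ [i]) (Y \<inter> A s)}"
    using Suc.IH large_mono child_subset by (smt (verit) Collect_mono Int_mono order_refl)
  with Suc.prems show ?case by (auto dest: finite_subset)
qed (simp add: Int_assoc)

lemma large_UNIV: "large h s UNIV"
  by (induction h arbitrary: s) (simp_all add: infinite_node)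

section \<open>Homogeneous sets with unbounded traces on columns\<close>

lemma large_end_homogeneous:
  fixes c :: "nat set \<Rightarrow> nat"
  assumes c: "\<forall>x y. x \<noteq> y \<longrightarrow> c {x, y} < n" and "n > 0" and "large h s Y"
  obtains d Z where "d < n" "antimono Z" "\<And>k. large h s (Z k)" "Z 0 \<subseteq> Y"
    "end_homogeneous c d Z"
    "\<And>b. \<exists>F\<subseteq>Y. finite F \<and> card F = b \<and> homogeneous c d F"
proof (rule end_homogeneous_sequence[where P = "large h s" and Y = Y and n = n and c = c])
  show "\<exists>d<n. large h s (W \<inter> F d)" if "large h s W" "W \<subseteq> (\<Union>d<n. F d)" for W F
    using that by (rule large_cover)
  show "large h s W'" if "large h s W" "W \<subseteq> W'" for W W'
    using that by (rule large_mono)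
  show "\<forall>x y. x \<noteq> y \<longrightarrow> c {x, y} < n" by (rule c)
  show "n > 0" "large h s Y" by fact+
next
  fix d Z
  assume dZ: "d < n" "antimono Z" "\<And>k. large h s (Z k)" "Z 0 \<subseteq> Y"
    "end_homogeneous c d Z"
  have inf: "infinite (Z k)" for k using infinite_if_large[OF dZ(3)[of k]] by auto
  have "\<exists>F\<subseteq>Y. finite F \<and> card F = b \<and> homogeneous c d F" for b
    using finite_homogeneous_subset[OF dZ(5) dZ(2) inf] dZ(4)
    by (meson order_trans)
  then show thesis using that dZ by blast
qed

text \<open>\<open>D\<close> collects the colours that may still have arbitrarily big homogeneous
  subsets of \<open>Y\<close>. The rank \<open>h\<close> bounds \<open>card D\<close>: each descent
  into a column costs one rank and removes one colour. Excluding sets of size exactly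
  \<open>b\<close> bounds all sizes, since subsets of homogeneous sets are homogeneous.\<close>

lemma homogeneous_unbounded_on_columns:
  fixes c :: "nat set \<Rightarrow> nat"
  assumes c: "\<forall>x y. x \<noteq> y \<longrightarrow> c {x, y} < n" and "n > 0"
  shows "large h s Y \<Longrightarrow> finite D \<Longrightarrow> card D \<le> h \<Longrightarrow>
    (\<And>d. d < n \<Longrightarrow> d \<notin> D \<Longrightarrow>
      \<exists>b. \<forall>F\<subseteq>Y. finite F \<longrightarrow> card F = b \<longrightarrow> \<not> homogeneous c d F) \<Longrightarrow>
    \<exists>X t d. homogeneous c d X \<and> (\<forall>b. \<exists>i\<ge>b. \<exists>F\<subseteq>X \<inter> A (t @ [i]). finite F \<and> card F = b)"
proof (induction h arbitrary: s Y D)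
  case (0 s Y D)
  obtain d Z where "d < n" and "\<And>b. \<exists>F\<subseteq>Y. finite F \<and> card F = b \<and> homogeneous c d F"
    by (rule large_end_homogeneous[OF c \<open>n > 0\<close> 0(1)]) (rule that)
  \<comment> \<open>At rank 0 the set \<open>D\<close> is empty, so every colour is bounded on
    \<open>Y\<close>, but the colour \<open>d\<close> just obtained is not.\<close>
  then show ?case using 0(2-4) by (metis card_eq_0_iff empty_iff le_zero_eq)
next
  case (Suc h s Y D)
  obtain d Z where dZ: "d < n" "antimono Z" "\<And>k. large (Suc h) s (Z k)" "Z 0 \<subseteq> Y"
    "end_homogeneous c d Z"
    and "\<And>b. \<exists>F\<subseteq>Y. finite F \<and> card F = b \<and> homogeneous c d F"
    by (rule large_end_homogeneous[OF c \<open>n > 0\<close> Suc.prems(1)]) (rule that)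
  then have "d \<in> D" using Suc.prems(4) by meson
  show ?case
  \<comment> \<open>Either some large piece of a column bounds the colour \<open>d\<close>, and the
    induction continues there with \<open>D - {d}\<close>, or all large pieces contain blocks of
    every size and these are glued.\<close>
  proof (cases "\<exists>k i b. large h (s @ [i]) (Z k) \<and>
      (\<forall>F\<subseteq>Z k \<inter> A (s @ [i]). finite F \<longrightarrow> card F = b \<longrightarrow> \<not> homogeneous c d F)")
    case True
    then obtain k i b where kib: "large h (s @ [i]) (Z k)"
      "\<forall>F\<subseteq>Z k \<inter> A (s @ [i]). finite F \<longrightarrow> card F = b \<longrightarrow> \<not> homogeneous c d F"
      by blast
    have sub: "Z k \<inter> A (s @ [i]) \<subseteq> Y" using antimonoD[OF dZ(2), of 0 k] dZ(4) by auto
    show ?thesis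
    proof (rule Suc.IH)
      show "large h (s @ [i]) (Z k \<inter> A (s @ [i]))" using kib(1) by (rule large_restrict)
      show "finite (D - {d})" using Suc.prems by simp
      show "card (D - {d}) \<le> h" using Suc.prems \<open>d \<in> D\<close> by simp
      show "\<exists>b. \<forall>F\<subseteq>Z k \<inter> A (s @ [i]). finite F \<longrightarrow> card F = b \<longrightarrow> \<not> homogeneous c e F"
        if e: "e < n" "e \<notin> D - {d}" for e
      proof (cases "e = d")
        case False
        then obtain b where "\<forall>F\<subseteq>Y. finite F \<longrightarrow> card F = b \<longrightarrow> \<not> homogeneous c e F"
          using e Suc.prems(4)[of e] False by blast
        then show ?thesis using order_trans[OF _ sub] by (intro exI[of _ b]) simp
      qed (use kib in blast)
    qed
  next
    case False
    have "\<exists>i\<ge>b. \<exists>F\<subseteq>Z k \<inter> A (s @ [i]). finite F \<and> card F = b \<and> homogeneous c d F" for k b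
    proof -
      \<comment> \<open>Infinitely many large columns allow the block to be found in a column with
        index at least \<open>b\<close>.\<close>
      have "infinite {i. large h (s @ [i]) (Z k)}"
        using dZ(3)[of k] by simp
      then obtain i where i: "i \<ge> b" "large h (s @ [i]) (Z k)"
        unfolding infinite_nat_iff_unbounded_le by blast
      have "\<not> (\<forall>F\<subseteq>Z k \<inter> A (s @ [i]). finite F \<longrightarrow> card F = b \<longrightarrow> \<not> homogeneous c d F)"
        using False i(2) by simp
      then show ?thesis using i(1) by (intro exI[of _ i]) simp
    qed
    from glue_homogeneous_sets[where C = "\<lambda>i. A (s @ [i])", OF dZ(5) dZ(2) this]
    show ?thesis by (elim exE) (intro exI)
  qed
qed

section \<open>Positivity for \<open>ED\<close>\<close>

text \<open>On \<open>A t\<close> this is a copy of the classical ideal ED on \<omega> \<times>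
  \<omega>, with the sets \<open>A (t @ [i])\<close> as vertical sections; outside
  \<open>A t\<close> nothing is required. Finiteness is stated separately because
  \<open>card\<close> is 0 on infinite sets.\<close>

definition column_bounded :: "nat list \<Rightarrow> nat set set" where
  "column_bounded t =
    {X. \<exists>k. finite {i. \<not> (finite (X \<inter> A (t @ [i])) \<and> card (X \<inter> A (t @ [i])) \<le> k)}}"

lemma column_boundedI:
  "finite {i. \<not> (finite (X \<inter> A (t @ [i])) \<and> card (X \<inter> A (t @ [i])) \<le> k)} \<Longrightarrow> X \<in> column_bounded t"
  by (auto simp: column_bounded_def)

lemma is_ideal_column_bounded: "is_ideal (column_bounded t)"
  unfolding is_ideal_def
proof (intro conjI allI ballI impI)
  fix X :: "nat set" assume "finite X"
  then show "X \<in> column_bounded t"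
    by (intro column_boundedI[where k = "card X"]) (simp add: card_mono)
next
  fix X Y assume "X \<in> column_bounded t" "Y \<subseteq> X"
  then obtain k where "finite {i. \<not> (finite (X \<inter> A (t @ [i])) \<and> card (X \<inter> A (t @ [i])) \<le> k)}"
    by (auto simp: column_bounded_def)
  moreover have "finite (Y \<inter> A (t @ [i])) \<and> card (Y \<inter> A (t @ [i])) \<le> k"
    if "finite (X \<inter> A (t @ [i])) \<and> card (X \<inter> A (t @ [i])) \<le> k" for i
    using that \<open>Y \<subseteq> X\<close> by (meson Int_mono card_mono finite_subset order_refl order_trans)
  ultimately show "Y \<in> column_bounded t"
    by (intro column_boundedI[where k = k]) (rule rev_finite_subset, assumption, blast)
next
  fix X Y assume "X \<in> column_bounded t" "Y \<in> column_bounded t"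
  then obtain k l where
    "finite ({i. \<not> (finite (X \<inter> A (t @ [i])) \<and> card (X \<inter> A (t @ [i])) \<le> k)} \<union>
      {i. \<not> (finite (Y \<inter> A (t @ [i])) \<and> card (Y \<inter> A (t @ [i])) \<le> l)})"
    by (auto simp: column_bounded_def)
  moreover have "finite ((X \<union> Y) \<inter> A (t @ [i])) \<and> card ((X \<union> Y) \<inter> A (t @ [i])) \<le> k + l"
    if "finite (X \<inter> A (t @ [i])) \<and> card (X \<inter> A (t @ [i])) \<le> k"
      "finite (Y \<inter> A (t @ [i])) \<and> card (Y \<inter> A (t @ [i])) \<le> l" for i
    using that card_Un_le[of "X \<inter> A (t @ [i])" "Y \<inter> A (t @ [i])"]
    by (simp add: Int_Un_distrib2)
  ultimately show "X \<union> Y \<in> column_bounded t"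
    by (intro column_boundedI[where k = "k + l"]) (rule rev_finite_subset, assumption, blast)
qed

text \<open>Only one column of \<open>t\<close> can meet \<open>A s\<close>, namely the one given by
  the initial segment of \<open>s\<close> of length \<open>length t + 1\<close>.\<close>

lemma longer_node_column_bounded:
  assumes "X \<subseteq> A s" "length t < length s"
  shows "X \<in> column_bounded t"
proof (rule column_boundedI[where k = 0])
  let ?u = "take (Suc (length t)) s"
  have "X \<inter> A (t @ [i]) = {}" if "t @ [i] \<noteq> ?u" for i
    using same_length_disjoint[of "t @ [i]" ?u] that assms take_superset[of s "Suc (length t)"]
    by auto
  then have "{i. \<not> (finite (X \<inter> A (t @ [i])) \<and> card (X \<inter> A (t @ [i])) \<le> 0)} \<subseteq> {last ?u}"
    by (auto, metis last_snoc finite.emptyI, metis last_snoc card.empty less_irrefl)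
  then show "finite {i. \<not> (finite (X \<inter> A (t @ [i])) \<and> card (X \<inter> A (t @ [i])) \<le> 0)}"
    by (rule finite_subset) simp
qed

text \<open>If \<open>s\<close> is not longer than \<open>t\<close>, each column of \<open>t\<close>
  is either disjoint from \<open>A s\<close> or inside a single \<open>A (s @ [j])\<close>, where
  \<open>X\<close> has one point.\<close>

lemma \<B>_column_bounded:
  assumes "X \<in> \<B> A"
  shows "X \<in> column_bounded t"
proof -
  obtain s where s: "X \<subseteq> A s" "\<And>j. card (X \<inter> A (s @ [j])) = 1"
    using assms by (auto simp: \<B>_def)
  show ?thesis
  proof (cases "length t < length s")
    case True
    then show ?thesis using s(1) longer_node_column_bounded by blast
  next
    case False
    have "finite (X \<inter> A (t @ [i])) \<and> card (X \<inter> A (t @ [i])) \<le> 1" for i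
    proof (cases "take (length s) (t @ [i]) = s")
      case True
      \<comment> \<open>This is the child of \<open>s\<close> towards the column; it equals
        \<open>i\<close> when \<open>t\<close> and \<open>s\<close> have the same length.\<close>
      let ?j = "(t @ [i]) ! length s"
      have "take (Suc (length s)) (t @ [i]) = s @ [?j]"
        using True False by (subst take_Suc_conv_app_nth) auto
      then have "X \<inter> A (t @ [i]) \<subseteq> X \<inter> A (s @ [?j])"
        using take_superset[of "t @ [i]" "Suc (length s)"] by auto
      moreover have "finite (X \<inter> A (s @ [?j]))"
        using s(2) by (metis card.infinite zero_neq_one)
      ultimately show ?thesis
        using s(2) by (metis card_mono finite_subset)
    next
      case neq: False
      have "A (take (length s) (t @ [i])) \<inter> A s = {}"
        by (rule same_length_disjoint) (use neq False in auto)
      then have "X \<inter> A (t @ [i]) = {}"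
        using s(1) take_superset[of "t @ [i]" "length s"] by blast
      then show ?thesis by simp
    qed
    then show ?thesis by (intro column_boundedI[where k = 1]) simp
  qed
qed

text \<open>The generating nodes have length \<open>m + 1\<close>, hence are strictly longer than
  \<open>t\<close>. So a set outside \<open>column_bounded t\<close> is positive for
  \<open>ED A m\<close>.\<close>

lemma ED_subset_column_bounded:
  "length t \<le> m \<Longrightarrow> ED A m \<subseteq> column_bounded t"
  unfolding ED_def
proof (rule ideal_gen_least[OF is_ideal_column_bounded], rule Un_least)
  assume "length t \<le> m"
  then show "\<A> A m \<subseteq> column_bounded t"
    by (auto simp: \<A>_def intro!: longer_node_column_bounded[OF order_refl])
  show "\<B> A \<subseteq> column_bounded t"
    using \<B>_column_bounded by blast
qed

lemma arrows_pairs_ED_omega: "arrows_pairs (positive (ED_omega A)) n"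
  unfolding arrows_pairs_def
proof (intro allI impI)
  fix c assume c: "c \<in> nsets (UNIV :: nat set) 2 \<rightarrow> {..<n}"
  have c': "c {x, y} < n" if "x \<noteq> y" for x y
    using that c by (auto simp: Pi_iff nsets_def)
  have "n > 0" using c'[of 0 1] by simp
  obtain X t d where X: "homogeneous c d X"
    "\<And>b. \<exists>i\<ge>b. \<exists>F\<subseteq>X \<inter> A (t @ [i]). finite F \<and> card F = b"
    \<comment> \<open>The induction starts at the root with all \<open>n\<close> colours in
      \<open>D\<close> and rank \<open>n\<close>, where no bound is demanded yet.\<close>
    using homogeneous_unbounded_on_columns[of c n n "[]" UNIV "{..<n}"] c' \<open>n > 0\<close> large_UNIV
    by auto
  have "X \<notin> column_bounded t"
  proof
    assume "X \<in> column_bounded t"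
    then obtain k where "finite {i. \<not> (finite (X \<inter> A (t @ [i])) \<and> card (X \<inter> A (t @ [i])) \<le> k)}"
      by (auto simp: column_bounded_def)
    then obtain N where N: "\<And>i. i \<ge> N \<Longrightarrow> finite (X \<inter> A (t @ [i])) \<and> card (X \<inter> A (t @ [i])) \<le> k"
      by (metis (mono_tags, lifting) finite_nat_set_iff_bounded mem_Collect_eq not_le)
    \<comment> \<open>The maximum puts the column beyond the exceptional ones and gives the block
      more than \<open>k\<close> points.\<close>
    obtain i F where "i \<ge> max N (Suc k)" "F \<subseteq> X \<inter> A (t @ [i])" "card F = max N (Suc k)"
      using X(2) by meson
    then show False using N[of i] card_mono[of "X \<inter> A (t @ [i])" F] by auto
  qed
  then have "X \<notin> ED_omega A"
    \<comment> \<open>Missing a single \<open>ED A m\<close> suffices for an intersection; the level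
      is \<open>m = length t\<close>.\<close>
    using ED_subset_column_bounded[of t "length t"] by (auto simp: ED_omega_def)
  moreover have "c ` nsets X 2 = {d}"
  proof
    show "c ` nsets X 2 \<subseteq> {d}"
      using X(1) by (auto simp: nsets_def card_2_iff homogeneous_def)
    \<comment> \<open>\<open>X\<close> must contain a pair, as otherwise the set of colours would be
      empty.\<close>
    obtain F where "F \<subseteq> X" "card F = 2" "finite F" using X(2)[of 2] by auto
    then have "F \<in> nsets X 2" by (simp add: nsets_def)
    then show "{d} \<subseteq> c ` nsets X 2" using \<open>c ` nsets X 2 \<subseteq> {d}\<close> by auto
  qed
  ultimately show "\<exists>X\<in>positive (ED_omega A). card (c ` nsets X 2) = 1"
    by (intro bexI[of _ X]) (auto simp: positive_def)
qed

section \<open>Comparison of \<open>PC\<close> with \<open>ED_omega\<close>\<close>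

lemma level_covers: "\<exists>s. length s = k \<and> x \<in> A s"
proof (induction k)
  case 0
  then show ?case using A by (auto simp: partition_family_def)
next
  case (Suc k)
  then obtain s where "length s = k" "x \<in> A s" by blast
  moreover have "(\<Union>i. A (s @ [i])) = A s" using A by (simp add: partition_family_def)
  ultimately obtain i where "x \<in> A (s @ [i])" by blast
  with \<open>length s = k\<close> show ?case by (intro exI[of _ "s @ [i]"]) simp
qed

text \<open>Level \<open>k + 1\<close> consists of the finitely many successors of finitely many
  nodes.\<close>

lemma small_branching_finite_level:
  assumes "small_branching (tree_of A X)"
  shows "finite {s \<in> tree_of A X. length s = k}"
proof (induction k)
  case 0
  then show ?case by (rule finite_subset[of _ "{[]}"]) auto
next
  case (Suc k)
  have "{s \<in> tree_of A X. length s = Suc k} \<subseteq>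
    (\<Union>s\<in>{s \<in> tree_of A X. length s = k}. (\<lambda>i. s @ [i]) ` {i. s @ [i] \<in> tree_of A X})"
  proof
    fix s assume s: "s \<in> {s \<in> tree_of A X. length s = Suc k}"
    then obtain r i where r: "s = r @ [i]" by (cases s rule: rev_cases) auto
    then have "r \<in> tree_of A X" using s child_subset[of r i] by (auto simp: tree_of_def)
    then show "s \<in> (\<Union>s\<in>{s \<in> tree_of A X. length s = k}. (\<lambda>i. s @ [i]) ` {i. s @ [i] \<in> tree_of A X})"
      using s r by auto
  qed
  then show ?case
    by (rule finite_subset) (use Suc assms in \<open>auto simp: small_branching_def\<close>)
qed

text \<open>The finitely many nodes of level \<open>m + 1\<close> that meet \<open>X\<close> cover
  \<open>X\<close>, and their sets generate \<open>ED A m\<close>.\<close>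

lemma small_branching_in_ED:
  assumes "small_branching (tree_of A X)"
  shows "X \<in> ED A m"
proof -
  let ?S = "A ` {s \<in> tree_of A X. length s = m + 1}"
  have "?S \<subseteq> ED A m"
    using ideal_gen_superset[of "\<A> A m \<union> \<B> A"] by (auto simp: ED_def \<A>_def)
  then have "\<Union>?S \<in> ED A m"
    using small_branching_finite_level[OF assms] is_ideal_ideal_gen
    by (intro ideal_finite_Union) (auto simp: ED_def)
  moreover have "X \<subseteq> \<Union>?S"
    using level_covers[of "m + 1"] by (fastforce simp: tree_of_def)
  ultimately show ?thesis
    using is_ideal_ideal_gen[of "\<A> A m \<union> \<B> A"] unfolding ED_def is_ideal_def by blast
qed

lemma PC_subset_ED_omega: "PC A \<subseteq> ED_omega A"
  unfolding ED_omega_def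
proof (rule INT_greatest)
  fix m
  show "PC A \<subseteq> ED A m"
    unfolding PC_def
  proof (rule ideal_gen_least)
    show "is_ideal (ED A m)" by (simp add: ED_def is_ideal_ideal_gen)
    show "\<B> A \<union> {X. small_branching (tree_of A X)} \<subseteq> ED A m"
      using small_branching_in_ED ideal_gen_superset[of "\<A> A m \<union> \<B> A"] by (auto simp: ED_def)
  qed
qed

end

theorem theorem2p2:
  fixes A :: "nat list \<Rightarrow> nat set" and n :: nat
  assumes "partition_family A"
  shows "arrows_pairs (positive (ED_omega A)) n \<and> arrows_pairs (positive (PC A)) n"
proof
  show "arrows_pairs (positive (ED_omega A)) n"
    using assms by (rule arrows_pairs_ED_omega)
  \<comment> \<open>The smaller ideal has more positive sets, so the same homogeneous set
    serves.\<close>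
  then show "arrows_pairs (positive (PC A)) n"
    using PC_subset_ED_omega[OF assms] unfolding arrows_pairs_def positive_def by blast
qed

end
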